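(* Let $\mathcal{A}\in\mathbb{C}^{m\times\ell\times n}$ be such that $\mathcal{A}_{i::}\mathcal{A}_{i::}^*\in\mathbb{C}^{1\times1\times n}$ is invertible (under the t-product) for every $i\in\{0,\dots,m-1\}$. Let $\mathcal{B}\in\mathbb{C}^{m\times p\times n}$ and let $\mathcal{X}^*\in\mathbb{C}^{\ell\times p\times n}$ satisfy $\mathcal{A}\mathcal{X}^*=\mathcal{B}$. Let $\mathcal{D}$ be a probability distribution on $\{0,\dots,m-1\}$, let $i_0,i_1,i_2,\dots$ be sampled independently from $\mathcal{D}$, let $\mathcal{X}^0\in\mathbb{C}^{\ell\times p\times n}$ be an initial iterate, and define for $t\ge 0$ $$\mathcal{X}^{t+1}=\mathcal{X}^t-\mathcal{A}_{i_t::}^*\left(\mathcal{A}_{i_t::}\mathcal{A}_{i_t::}^*\right)^{-1}\left(\mathcal{A}_{i_t::}\mathcal{X}^t-\mathcal{B}_{i_t::}\right).$$ Put $\mathcal{P}_i=\mathcal{A}_{i::}^*\left(\mathcal{A}_{i::}\mathcal{A}_{i::}^*\right)^{-1}\mathcal{A}_{i::}$. Then for every $t\ge 0$ $$\mathbb{E}\left[\|\mathcal{X}^{t+1}-\mathcal{X}^*\|_F^2\,\middle|\,\mathcal{X}^0\right]\le\left(1-\sigma_{\min}\left(\mathbb{E}\left[\mathrm{bcirc}(\mathcal{P}_i)\right]\right)\right)^{t+1}\|\mathcal{X}^0-\mathcal{X}^*\|_F^2,$$ where the expectation on the right is over $i\sim\mathcal{D}$, the expectation on the left is over the sampled indices $i_0,\dots,i_t$,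 and $\sigma_{\min}$ denotes the smallest singular value. (Here $\mathcal{X}^*$ is the name of the solution, not a transpose.)
   Context: Indices start at 0. For a third-order tensor $\mathcal{M}\in\mathbb{C}^{m\times\ell\times n}$: $\mathbf{M}_k=\mathcal{M}_{::k}\in\mathbb{C}^{m\times\ell}$ ($0\le k\le n-1$) is its $k$-th frontal slice; $\mathcal{M}_{i::}\in\mathbb{C}^{1\times\ell\times n}$ is its $i$-th row slice; $\|\mathcal{M}\|_F^2$ is the sum of the squared moduli of all entries. $\mathrm{unfold}(\mathcal{M})\in\mathbb{C}^{mn\times\ell}$ is the matrix obtained by stacking $\mathbf{M}_0,\dots,\mathbf{M}_{n-1}$ vertically, and $\mathrm{fold}$ is its inverse. $\mathrm{bcirc}(\mathcal{M})\in\mathbb{C}^{mn\times\ell n}$ is the block-circulant matrix whose $(r,s)$ block ($0\le r,s\le n-1$) is $\mathbf{M}_{(r-s)\bmod n}$. The t-product of $\mathcal{A}\in\mathbb{C}^{m\times\ell\times n}$ and $\mathcal{B}\in\mathbb{C}^{\ell\times p\times n}$ is $\mathcal{A}\mathcal{B}=\mathrm{fold}(\mathrm{bcirc}(\mathcal{A})\,\mathrm{unfold}(\mathcal{B}))\in\mathbb{C}^{m\times p\times n}$; all tensor products are t-products. The identity tensor $\mathcal{I}\in\mathbb{C}^{m\times m\times n}$ has first frontal slice $\mathbf{I}_m$ and all other entries zero. A tensor $\mathcal{M}$ is invertible if there is $\mathcal{M}^{-1}$ with $\mathcal{M}\mathcal{M}^{-1}=\mathcal{M}^{-1}\mathcal{M}=\mathcal{I}$.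 The conjugate transpose $\mathcal{M}^*\in\mathbb{C}^{\ell\times m\times n}$ is obtained by conjugate-transposing every frontal slice and reversing the order of slices $1,\dots,n-1$, i.e. $(\mathcal{M}^* )_{::0}=\mathbf{M}_0^*$ and $(\mathcal{M}^* )_{::k}=\mathbf{M}_{n-k}^*$ for $1\le k\le n-1$. We write $\mathcal{A}_{i::}^*=(\mathcal{A}_{i::})^*$. *)

theory Defs
  imports "HOL-Probability.Probability" "Jordan_Normal_Form.Schur_Decomposition"
begin

text \<open>A third-order tensor is the list of its frontal slices. The carrier set records its format;
  for a nonempty list the format is determined by the tensor itself.\<close>

type_synonym tensor = "complex mat list"

definition carrier_tensor :: "nat \<Rightarrow> nat \<Rightarrow> nat \<Rightarrow> tensor set" where
  "carrier_tensor m l n = {T. length T = n \<and> set T \<subseteq> carrier_mat m l}"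

definition tdim_row :: "tensor \<Rightarrow> nat" where
  "tdim_row T = dim_row (T ! 0)"

definition tdim_col :: "tensor \<Rightarrow> nat" where
  "tdim_col T = dim_col (T ! 0)"

definition row_slice :: "tensor \<Rightarrow> nat \<Rightarrow> tensor" where
  "row_slice T i = map (\<lambda>S. Matrix.mat 1 (dim_col S) (\<lambda>(_, j). S $$ (i, j))) T"

definition frob_sq :: "tensor \<Rightarrow> real" where
  "frob_sq T = (\<Sum>S\<leftarrow>T. \<Sum>i<dim_row S. \<Sum>j<dim_col S. (cmod (S $$ (i, j)))\<^sup>2)"

definition tunfold :: "tensor \<Rightarrow> complex mat" where
  "tunfold T = (let m = tdim_row T in
     Matrix.mat (m * length T) (tdim_col T) (\<lambda>(r, j). (T ! (r div m)) $$ (r mod m, j)))"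

definition tfold :: "nat \<Rightarrow> nat \<Rightarrow> complex mat \<Rightarrow> tensor" where
  "tfold m n U = map (\<lambda>k. Matrix.mat m (dim_col U) (\<lambda>(i, j). U $$ (k * m + i, j))) [0..<n]"

text \<open>Since \<open>c div l < n\<close>, the slice index below is the difference of the block indices
  modulo \<open>n\<close>, without truncated subtraction.\<close>

definition bcirc :: "tensor \<Rightarrow> complex mat" where
  "bcirc T = (let m = tdim_row T; l = tdim_col T; n = length T in
     Matrix.mat (m * n) (l * n)
       (\<lambda>(r, c). (T ! ((r div m + n - c div l) mod n)) $$ (r mod m, c mod l)))"

definition tprod :: "tensor \<Rightarrow> tensor \<Rightarrow> tensor" (infixl "*\<^sub>t" 70) where
  "A *\<^sub>t B = tfold (tdim_row A) (length A) (bcirc A * tunfold B)"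

definition tminus :: "tensor \<Rightarrow> tensor \<Rightarrow> tensor" (infixl "-\<^sub>t" 65) where
  "A -\<^sub>t B = map2 (-) A B"

definition tone :: "nat \<Rightarrow> nat \<Rightarrow> tensor" where
  "tone m n = map (\<lambda>k. if k = 0 then 1\<^sub>m m else 0\<^sub>m m m) [0..<n]"

text \<open>The index \<open>(n - k) mod n\<close> is \<open>0\<close> for \<open>k = 0\<close> and \<open>n - k\<close> for \<open>0 < k < n\<close>.\<close>

definition tadjoint :: "tensor \<Rightarrow> tensor" where
  "tadjoint T = (let n = length T in map (\<lambda>k. mat_adjoint (T ! ((n - k) mod n))) [0..<n])"

definition is_tinverse :: "tensor \<Rightarrow> tensor \<Rightarrow> bool" where
  "is_tinverse T S \<longleftrightarrow> (let m = tdim_row T; n = length T in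
     T \<in> carrier_tensor m m n \<and> S \<in> carrier_tensor m m n \<and>
     T *\<^sub>t S = tone m n \<and> S *\<^sub>t T = tone m n)"

definition tinvertible :: "tensor \<Rightarrow> bool" where
  "tinvertible T \<longleftrightarrow> (\<exists>S. is_tinverse T S)"

definition tinverse :: "tensor \<Rightarrow> tensor" where
  "tinverse T = (THE S. is_tinverse T S)"

definition row_projection :: "tensor \<Rightarrow> nat \<Rightarrow> tensor" where
  "row_projection A i =
     (let R = row_slice A i in tadjoint R *\<^sub>t tinverse (R *\<^sub>t tadjoint R) *\<^sub>t R)"

primrec kaczmarz :: "tensor \<Rightarrow> tensor \<Rightarrow> tensor \<Rightarrow> (nat \<Rightarrow> nat) \<Rightarrow> nat \<Rightarrow> tensor" where
  "kaczmarz A B X0 i 0 = X0"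
| "kaczmarz A B X0 i (Suc t) =
     (let X = kaczmarz A B X0 i t; R = row_slice A (i t) in
      X -\<^sub>t tadjoint R *\<^sub>t tinverse (R *\<^sub>t tadjoint R) *\<^sub>t (R *\<^sub>t X -\<^sub>t row_slice B (i t)))"

definition expectation_mat ::
    "nat pmf \<Rightarrow> nat \<Rightarrow> nat \<Rightarrow> (nat \<Rightarrow> complex mat) \<Rightarrow> complex mat" where
  "expectation_mat D nr nc F =
     Matrix.mat nr nc (\<lambda>(r, c). measure_pmf.expectation D (\<lambda>i. F i $$ (r, c)))"

text \<open>Using the smaller of the two Gram matrices yields exactly the \<open>min nr nc\<close> singular values of
  an \<open>nr \<times> nc\<close> matrix, without spurious zeros in the rectangular case.\<close>

definition singular_values :: "complex mat \<Rightarrow> real set" where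
  "singular_values M =
     (let G = (if dim_row M < dim_col M then M * mat_adjoint M else mat_adjoint M * M)
      in {s. 0 \<le> s \<and> eigenvalue G (complex_of_real (s\<^sup>2))})"

definition sigma_min :: "complex mat \<Rightarrow> real" where
  "sigma_min M = Min (singular_values M)"

end

theory Submission
  imports Defs
begin

text \<open>Unfolding turns one step of the iteration into \<open>Z \<mapsto> (1 - bcirc \<P>\<^sub>i) Z\<close> for the error
  \<open>Z = unfold (\<X>\<^sup>t - \<X>\<^sup>*)\<close>, because \<open>bcirc\<close> is an injective *-homomorphism. Each
  \<open>bcirc \<P>\<^sub>i\<close> is an orthogonal projection, so a step decreases the squared norm of a column \<open>z\<close> by
  \<open>\<langle>bcirc \<P>\<^sub>i z, z\<rangle>\<close>, and the mean decrease is at least the smallest eigenvalue of the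
  positive semidefinite matrix \<open>E[bcirc \<P>\<^sub>i]\<close> times \<open>\<parallel>z\<parallel>\<^sup>2\<close>. Independence of the indices
  lets this one-step bound be iterated.\<close>

section \<open>Tensors as block-circulant matrices\<close>

text \<open>The bound is stated with a singular value, while the decrease in one step is a Rayleigh
  quotient. Only one direction of the comparison is needed: if \<open>c\<close> is the infimum of
  the Rayleigh quotient of the averaged matrix \<open>H\<close> and is an eigenvalue, then
  \<open>c^2\<close> is an eigenvalue of the Gram matrix \<open>H * H\<close>, so \<open>c\<close>
  competes in the minimum defining \<open>sigma_min H\<close>. That the infimum is an eigenvalue
  comes from a maximality argument rather than from a diagonalization.

  Conditional expectations are avoided too. After finitely many draws from a finite set, the
  expected error is a finite weighted sum over index words, and the last letter of a word can be
  summed separately.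

  A one-step bound with factor \<open>q\<close> can be iterated directly only for \<open>q\<close>
  \<ge> 0. The sign of 1 - \<open>sigma_min H\<close> is never determined; instead, a negative
  factor is shown to force all expected errors to vanish.\<close>

lemma carrier_tensorI:
  assumes "length T = n" "\<And>k. k < n \<Longrightarrow> T ! k \<in> carrier_mat m l"
  shows "T \<in> carrier_tensor m l n"
  using assms unfolding carrier_tensor_def by (auto simp: in_set_conv_nth)

lemma carrier_tensorD:
  assumes "T \<in> carrier_tensor m l n"
  shows "length T = n" "k < n \<Longrightarrow> T ! k \<in> carrier_mat m l"
    "k < n \<Longrightarrow> dim_row (T ! k) = m" "k < n \<Longrightarrow> dim_col (T ! k) = l"
proof -
  show "length T = n"
    using assms by (simp add: carrier_tensor_def)
  show *: "T ! k \<in> carrier_mat m l" if "k < n" for k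
    using assms that nth_mem unfolding carrier_tensor_def by fastforce
  show "k < n \<Longrightarrow> dim_row (T ! k) = m" "k < n \<Longrightarrow> dim_col (T ! k) = l"
    using * by blast+
qed

lemma tensor_eqI:
  assumes "S \<in> carrier_tensor m l n" "T \<in> carrier_tensor m l n"
    and "\<And>k i j. k < n \<Longrightarrow> i < m \<Longrightarrow> j < l \<Longrightarrow> S ! k $$ (i, j) = T ! k $$ (i, j)"
  shows "S = T"
  using assms by (intro nth_equalityI eq_matI) (simp_all add: carrier_tensorD)

lemma tensor_dims:
  assumes "T \<in> carrier_tensor m l n" "0 < n"
  shows "tdim_row T = m" "tdim_col T = l"
  using carrier_tensorD[OF assms(1)] assms(2) by (auto simp: tdim_row_def tdim_col_def)

section \<open>Arithmetic of block indices and of differences modulo n\<close>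

lemma block_index_less:
  fixes r m n :: nat
  assumes "r < m * n"
  shows "r div m < n" "r mod m < m"
proof -
  show "r div m < n" using assms by (simp add: less_mult_imp_div_less mult.commute)
  show "r mod m < m" using assms by (cases "m = 0") auto
qed

lemma block_index_bound:
  fixes i k m n :: nat
  assumes "k < n" "i < m"
  shows "k * m + i < m * n"
proof -
  have "k * m + i < Suc k * m" using assms by simp
  also have "\<dots> \<le> n * m" using assms by (intro mult_le_mono1) simp
  finally show ?thesis by (simp add: mult.commute)
qed

text \<open>A flat index \<open>q = s * l + h\<close> encodes block \<open>s\<close> and position
  \<open>h\<close> inside it; this passes between sums in matrix products and sums in
  t-products.\<close>

lemma sum_div_mod:
  fixes f :: "nat \<Rightarrow> nat \<Rightarrow> 'a :: comm_monoid_add"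
  shows "(\<Sum>q<l * n. f (q div l) (q mod l)) = (\<Sum>s<n. \<Sum>h<l. f s h)"
  unfolding sum.cartesian_product
  by (rule sum.reindex_bij_witness[where i = "\<lambda>(s, h). s * l + h" and j = "\<lambda>q. (q div l, q mod l)"])
     (auto simp: block_index_less block_index_bound)

lemma cyclic_diff:
  fixes a b n :: nat
  assumes "a < n" "b < n"
  shows "(a + n - b) mod n = (if b \<le> a then a - b else a + n - b)"
proof (cases "b \<le> a")
  case True
  have "(a + n - b) mod n = (a - b + n) mod n"
    by (simp only: Nat.diff_add_assoc2[OF True])
  also have "\<dots> = a - b"
    using assms(1) by simp
  finally show ?thesis using True by simp
qed (use assms in simp)

lemma int_cyclic_diff:
  fixes a b n :: nat
  assumes "b < n"
  shows "int ((a + n - b) mod n) = (int a - int b) mod int n"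
proof -
  have "int ((a + n - b) mod n) = (int a - int b + int n) mod int n"
    using assms by (simp add: zmod_int of_nat_diff algebra_simps)
  thus ?thesis by simp
qed

text \<open>The common offset \<open>b\<close> cancels in the group of residues modulo
  \<open>n\<close>; the integers serve to escape truncated subtraction. This cancellation is what
  makes block-circulant matrices closed under products and adjoints.\<close>

lemma cyclic_diff_diff:
  fixes a b c n :: nat
  assumes "a < n" "b < n" "c < n"
  shows "((a + n - b) mod n + n - (c + n - b) mod n) mod n = (a + n - c) mod n"
proof -
  have "int (((a + n - b) mod n + n - (c + n - b) mod n) mod n) =
      ((int a - int b) mod int n - (int c - int b) mod int n) mod int n"
    using assms by (simp add: int_cyclic_diff)
  also have "\<dots> = int ((a + n - c) mod n)"
    using assms by (simp add: mod_diff_eq int_cyclic_diff)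
  finally show ?thesis by (simp only: of_nat_eq_iff)
qed

lemma sum_cyclic_shift:
  fixes f :: "nat \<Rightarrow> 'a :: comm_monoid_add"
  assumes "c < n"
  shows "(\<Sum>s<n. f ((s + n - c) mod n)) = (\<Sum>s<n. f s)"
proof (rule sum.reindex_bij_witness[where i = "\<lambda>s. (s + c) mod n" and j = "\<lambda>s. (s + n - c) mod n"])
  fix s assume "s \<in> {..<n}"
  hence s: "s < n" by simp
  show "((s + n - c) mod n + c) mod n = s"
    using s assms by (simp add: cyclic_diff)
  show "((s + c) mod n + n - c) mod n = s"
  proof (cases "s + c < n")
    case False
    hence "(s + c) mod n = s + c - n"
      using s assms by (simp add: mod_if)
    thus ?thesis using False s assms by simp
  qed (use s in simp)
qed (use assms in auto)

section \<open>\<open>bcirc\<close> and \<open>tunfold\<close> under the tensor operations\<close>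

lemma bcirc_carrier:
  assumes "T \<in> carrier_tensor m l n" "0 < n"
  shows "bcirc T \<in> carrier_mat (m * n) (l * n)"
  using tensor_dims[OF assms] carrier_tensorD(1)[OF assms(1)]
  by (simp add: bcirc_def Let_def)

lemma bcirc_index:
  assumes "T \<in> carrier_tensor m l n" "r < m * n" "c < l * n"
  shows "bcirc T $$ (r, c) = T ! ((r div m + n - c div l) mod n) $$ (r mod m, c mod l)"
proof -
  have "0 < n" using assms(2) by (cases n) auto
  thus ?thesis
    using tensor_dims[OF assms(1)] carrier_tensorD(1)[OF assms(1)] assms(2,3)
    by (simp add: bcirc_def Let_def)
qed

lemma tunfold_carrier:
  assumes "T \<in> carrier_tensor m l n" "0 < n"
  shows "tunfold T \<in> carrier_mat (m * n) l"
  using tensor_dims[OF assms] carrier_tensorD(1)[OF assms(1)]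
  by (simp add: tunfold_def Let_def)

lemma tunfold_index:
  assumes "T \<in> carrier_tensor m l n" "r < m * n" "j < l"
  shows "tunfold T $$ (r, j) = T ! (r div m) $$ (r mod m, j)"
proof -
  have "0 < n" using assms(2) by (cases n) auto
  thus ?thesis
    using tensor_dims[OF assms(1)] carrier_tensorD(1)[OF assms(1)] assms(2,3)
    by (simp add: tunfold_def Let_def)
qed

text \<open>The first block column of \<open>bcirc\<close> lists the frontal slices in order, so it
  alone recovers the tensor.\<close>

lemma bcirc_inject:
  assumes "S \<in> carrier_tensor m l n" "T \<in> carrier_tensor m l n" "bcirc S = bcirc T"
  shows "S = T"
proof (rule tensor_eqI[OF assms(1,2)])
  fix k i j assume kij: "k < n" "i < m" "j < l"
  moreover from this have "k * m + i < m * n"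
    by (simp add: block_index_bound)
  moreover have "j < l * n"
    using block_index_bound[of 0 n j l] kij by simp
  ultimately show "S ! k $$ (i, j) = T ! k $$ (i, j)"
    using arg_cong[OF assms(3), of "\<lambda>U. U $$ (k * m + i, j)"] assms(1,2)
    by (simp add: bcirc_index)
qed

lemma tprod_carrier:
  assumes "A \<in> carrier_tensor m l n" "B \<in> carrier_tensor l p n" "0 < n"
  shows "A *\<^sub>t B \<in> carrier_tensor m p n"
  using assms tunfold_carrier[OF assms(2,3)]
  by (intro carrier_tensorI) (auto simp: tprod_def tfold_def tensor_dims carrier_tensorD)

lemma tunfold_tprod:
  assumes "A \<in> carrier_tensor m l n" "B \<in> carrier_tensor l p n" "0 < n"
  shows "tunfold (A *\<^sub>t B) = bcirc A * tunfold B"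
proof (rule eq_matI)
  note AB = tprod_carrier[OF assms]
  note c = tunfold_carrier[OF AB assms(3)] tunfold_carrier[OF assms(2,3)] bcirc_carrier[OF assms(1,3)]
  show "dim_row (tunfold (A *\<^sub>t B)) = dim_row (bcirc A * tunfold B)"
    "dim_col (tunfold (A *\<^sub>t B)) = dim_col (bcirc A * tunfold B)"
    using c by auto
  fix r j assume "r < dim_row (bcirc A * tunfold B)" "j < dim_col (bcirc A * tunfold B)"
  hence rj: "r < m * n" "j < p" using c by auto
  show "tunfold (A *\<^sub>t B) $$ (r, j) = (bcirc A * tunfold B) $$ (r, j)"
    unfolding tunfold_index[OF AB rj]
    using assms rj c by (simp add: block_index_less tprod_def tfold_def tensor_dims carrier_tensorD)
qed

lemma tprod_index:
  assumes "A \<in> carrier_tensor m l n" "B \<in> carrier_tensor l p n" "k < n" "i < m" "j < p"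
  shows "(A *\<^sub>t B) ! k $$ (i, j) =
    (\<Sum>s<n. \<Sum>h<l. A ! ((k + n - s) mod n) $$ (i, h) * B ! s $$ (h, j))"
proof -
  have n: "0 < n" using assms(3) by simp
  note c = tunfold_carrier[OF assms(2) n] bcirc_carrier[OF assms(1) n]
  have r: "k * m + i < m * n"
    using assms by (simp add: block_index_bound)
  have "(A *\<^sub>t B) ! k $$ (i, j) = (bcirc A * tunfold B) $$ (k * m + i, j)"
    using assms c n by (simp add: tprod_def tfold_def tensor_dims carrier_tensorD)
  also have "\<dots> = (\<Sum>q<l * n. bcirc A $$ (k * m + i, q) * tunfold B $$ (q, j))"
    using c r assms(5) by (auto simp: scalar_prod_def atLeast0LessThan intro!: sum.cong)
  also have "\<dots> = (\<Sum>q<l * n. A ! ((k + n - q div l) mod n) $$ (i, q mod l) * B ! (q div l) $$ (q mod l, j))"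
    using r assms by (intro sum.cong) (auto simp: bcirc_index tunfold_index)
  also have "\<dots> = (\<Sum>s<n. \<Sum>h<l. A ! ((k + n - s) mod n) $$ (i, h) * B ! s $$ (h, j))"
    by (rule sum_div_mod[where f = "\<lambda>s h. A ! ((k + n - s) mod n) $$ (i, h) * B ! s $$ (h, j)"])
  finally show ?thesis .
qed

lemma bcirc_tprod:
  assumes "A \<in> carrier_tensor m l n" "B \<in> carrier_tensor l p n" "0 < n"
  shows "bcirc (A *\<^sub>t B) = bcirc A * bcirc B"
proof (rule eq_matI)
  note AB = tprod_carrier[OF assms]
  note c = bcirc_carrier[OF AB assms(3)] bcirc_carrier[OF assms(1,3)] bcirc_carrier[OF assms(2,3)]
  show "dim_row (bcirc (A *\<^sub>t B)) = dim_row (bcirc A * bcirc B)"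
    "dim_col (bcirc (A *\<^sub>t B)) = dim_col (bcirc A * bcirc B)"
    using c by auto
  fix r q assume "r < dim_row (bcirc A * bcirc B)" "q < dim_col (bcirc A * bcirc B)"
  hence rq: "r < m * n" "q < p * n" using c by auto
  note b = block_index_less[OF rq(1)] block_index_less[OF rq(2)]
  have "bcirc (A *\<^sub>t B) $$ (r, q) =
      (\<Sum>s<n. \<Sum>h<l. A ! (((r div m + n - q div p) mod n + n - s) mod n) $$ (r mod m, h)
        * B ! s $$ (h, q mod p))"
    using AB rq b assms by (simp add: bcirc_index tprod_index)
  \<comment> \<open>Shifting the summation index by the block column \<open>q div p\<close> turns
    the slice of \<open>B\<close> into the one found in block \<open>(s, q div p)\<close> of
    \<open>bcirc B\<close>. The same offset then cancels in the slice index of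
    \<open>A\<close>.\<close>
  also have "\<dots> = (\<Sum>s<n. \<Sum>h<l.
      A ! (((r div m + n - q div p) mod n + n - (s + n - q div p) mod n) mod n) $$ (r mod m, h)
        * B ! ((s + n - q div p) mod n) $$ (h, q mod p))"
    by (rule sum_cyclic_shift[OF b(3), symmetric])
  also have "\<dots> = (\<Sum>s<n. \<Sum>h<l. A ! ((r div m + n - s) mod n) $$ (r mod m, h)
        * B ! ((s + n - q div p) mod n) $$ (h, q mod p))"
  proof (rule sum.cong[OF refl])
    fix s assume "s \<in> {..<n}"
    hence "((r div m + n - q div p) mod n + n - (s + n - q div p) mod n) mod n = (r div m + n - s) mod n"
      using b by (simp add: cyclic_diff_diff)
    thus "(\<Sum>h<l. A ! (((r div m + n - q div p) mod n + n - (s + n - q div p) mod n) mod n) $$ (r mod m, h)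
        * B ! ((s + n - q div p) mod n) $$ (h, q mod p)) =
      (\<Sum>h<l. A ! ((r div m + n - s) mod n) $$ (r mod m, h)
        * B ! ((s + n - q div p) mod n) $$ (h, q mod p))"
      by (simp only:)
  qed
  also have "\<dots> = (\<Sum>x<l * n. bcirc A $$ (r, x) * bcirc B $$ (x, q))"
    using rq assms by (simp add: sum_div_mod[symmetric] bcirc_index)
  also have "\<dots> = (bcirc A * bcirc B) $$ (r, q)"
    using c rq by (auto simp: scalar_prod_def atLeast0LessThan intro!: sum.cong)
  finally show "bcirc (A *\<^sub>t B) $$ (r, q) = (bcirc A * bcirc B) $$ (r, q)" .
qed

lemma mat_adjoint_carrier:
  "M \<in> carrier_mat r c \<Longrightarrow> mat_adjoint M \<in> carrier_mat c r"
  by (auto simp: mat_adjoint_def mat_of_rows_def)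

lemma mat_adjoint_index:
  assumes "M \<in> carrier_mat r c" "i < c" "j < r"
  shows "mat_adjoint M $$ (i, j) = conjugate (M $$ (j, i))"
  using assms by (auto simp: mat_adjoint_def mat_of_rows_def)

lemma tadjoint_carrier:
  assumes "T \<in> carrier_tensor m l n"
  shows "tadjoint T \<in> carrier_tensor l m n"
  using assms
  by (intro carrier_tensorI) (auto simp: tadjoint_def Let_def carrier_tensorD intro!: mat_adjoint_carrier)

lemma bcirc_tadjoint:
  assumes "T \<in> carrier_tensor m l n" "0 < n"
  shows "bcirc (tadjoint T) = mat_adjoint (bcirc T)"
proof (rule eq_matI)
  note T = tadjoint_carrier[OF assms(1)]
  note c = bcirc_carrier[OF T assms(2)] mat_adjoint_carrier[OF bcirc_carrier[OF assms]]
  show "dim_row (bcirc (tadjoint T)) = dim_row (mat_adjoint (bcirc T))"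
    "dim_col (bcirc (tadjoint T)) = dim_col (mat_adjoint (bcirc T))"
    using c by auto
  fix r q assume "r < dim_row (mat_adjoint (bcirc T))" "q < dim_col (mat_adjoint (bcirc T))"
  hence rq: "r < l * n" "q < m * n" using c by auto
  note b = block_index_less[OF rq(1)] block_index_less[OF rq(2)]
  \<comment> \<open>Reversing the slice order must exchange block row and block column. Writing the
    missing leading zero as the cyclic difference of \<open>q div m\<close> with itself makes this
    an instance of \<open>cyclic_diff_diff\<close>.\<close>
  have k: "(n - (r div l + n - q div m) mod n) mod n = (q div m + n - r div l) mod n"
  proof -
    have "(n - (r div l + n - q div m) mod n) mod n =
        ((q div m + n - q div m) mod n + n - (r div l + n - q div m) mod n) mod n"
      by simp
    thus ?thesis
      using b by (simp only: cyclic_diff_diff)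
  qed
  show "bcirc (tadjoint T) $$ (r, q) = mat_adjoint (bcirc T) $$ (r, q)"
    unfolding bcirc_index[OF T rq] mat_adjoint_index[OF bcirc_carrier[OF assms] rq]
      bcirc_index[OF assms(1) rq(2,1)]
    using assms b rq carrier_tensorD[OF assms(1)]
    by (simp add: tadjoint_def Let_def k mat_adjoint_index[where r = m and c = l])
qed

lemma tone_carrier: "tone m n \<in> carrier_tensor m m n"
  by (intro carrier_tensorI) (auto simp: tone_def)

lemma bcirc_tone:
  assumes "0 < n"
  shows "bcirc (tone m n) = 1\<^sub>m (m * n)"
proof (rule eq_matI)
  note c = bcirc_carrier[OF tone_carrier assms]
  show "dim_row (bcirc (tone m n)) = dim_row (1\<^sub>m (m * n))"
    "dim_col (bcirc (tone m n)) = dim_col (1\<^sub>m (m * n))"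
    using c[of m] by auto
  fix r q assume "r < dim_row (1\<^sub>m (m * n))" "q < dim_col (1\<^sub>m (m * n))"
  hence rq: "r < m * n" "q < m * n" by auto
  note b = block_index_less[OF rq(1)] block_index_less[OF rq(2)]
  have "r = q \<longleftrightarrow> r div m = q div m \<and> r mod m = q mod m"
    by (metis div_mult_mod_eq)
  thus "bcirc (tone m n) $$ (r, q) = 1\<^sub>m (m * n) $$ (r, q)"
    unfolding bcirc_index[OF tone_carrier rq]
    using assms rq b by (auto simp: tone_def cyclic_diff)
qed

lemma tminus_carrier:
  assumes "S \<in> carrier_tensor m l n" "T \<in> carrier_tensor m l n"
  shows "S -\<^sub>t T \<in> carrier_tensor m l n"
  using assms by (intro carrier_tensorI) (auto simp: tminus_def carrier_tensorD minus_carrier_mat)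

lemma tunfold_tminus:
  assumes "S \<in> carrier_tensor m l n" "T \<in> carrier_tensor m l n" "0 < n"
  shows "tunfold (S -\<^sub>t T) = tunfold S - tunfold T"
  using assms tminus_carrier[OF assms(1,2)] tunfold_carrier[OF assms(1,3)] tunfold_carrier[OF assms(2,3)]
    tunfold_carrier[OF tminus_carrier[OF assms(1,2)] assms(3)]
  by (intro eq_matI) (auto simp: tunfold_index tminus_def block_index_less carrier_tensorD)

lemma row_slice_carrier:
  assumes "T \<in> carrier_tensor m l n"
  shows "row_slice T i \<in> carrier_tensor 1 l n"
  using assms by (intro carrier_tensorI) (auto simp: row_slice_def carrier_tensorD)

text \<open>Row \<open>i\<close> of a t-product involves only row \<open>i\<close> of the left
  factor. For a consistent system this makes the data \<open>row_slice B i\<close> equal to the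
  sampled row applied to the solution.\<close>

lemma row_slice_tprod:
  assumes "A \<in> carrier_tensor m l n" "B \<in> carrier_tensor l p n" "0 < n" "i < m"
  shows "row_slice (A *\<^sub>t B) i = row_slice A i *\<^sub>t B"
proof (rule tensor_eqI)
  note AB = tprod_carrier[OF assms(1-3)] and R = row_slice_carrier[OF assms(1), of i]
  show "row_slice (A *\<^sub>t B) i \<in> carrier_tensor 1 p n"
    by (rule row_slice_carrier[OF AB])
  show "row_slice A i *\<^sub>t B \<in> carrier_tensor 1 p n"
    by (rule tprod_carrier[OF R assms(2,3)])
  fix k a j assume k: "k < n" and a: "a < (1::nat)" and j: "j < p"
  have "row_slice (A *\<^sub>t B) i ! k $$ (a, j) = (A *\<^sub>t B) ! k $$ (i, j)"
    using k a j by (simp add: row_slice_def carrier_tensorD[OF AB])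
  thus "row_slice (A *\<^sub>t B) i ! k $$ (a, j) = (row_slice A i *\<^sub>t B) ! k $$ (a, j)"
    unfolding tprod_index[OF R assms(2) k a j] tprod_index[OF assms(1,2) k assms(4) j]
    using a carrier_tensorD[OF assms(1)] by (simp add: row_slice_def)
qed

lemma frob_sq_tunfold:
  assumes "T \<in> carrier_tensor m l n" "0 < n"
  shows "frob_sq T = (\<Sum>j<l. \<Sum>r<m * n. (cmod (tunfold T $$ (r, j)))\<^sup>2)"
proof -
  have "frob_sq T = (\<Sum>k<n. \<Sum>i<m. \<Sum>j<l. (cmod (T ! k $$ (i, j)))\<^sup>2)"
    using assms by (simp add: frob_sq_def sum_list_sum_nth carrier_tensorD atLeast0LessThan)
  also have "\<dots> = (\<Sum>r<m * n. \<Sum>j<l. (cmod (tunfold T $$ (r, j)))\<^sup>2)"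
    by (subst sum_div_mod[symmetric]) (use assms in \<open>simp add: tunfold_index\<close>)
  also have "\<dots> = (\<Sum>j<l. \<Sum>r<m * n. (cmod (tunfold T $$ (r, j)))\<^sup>2)"
    by (rule sum.swap)
  finally show ?thesis .
qed

section \<open>Rayleigh quotients of positive semidefinite matrices\<close>

lemma cscalar_prod_self:
  fixes v :: "complex vec"
  assumes "v \<in> carrier_vec d"
  shows "v \<bullet>c v = complex_of_real (\<Sum>i<d. (cmod (v $ i))\<^sup>2)"
  using assms by (simp add: scalar_prod_def atLeast0LessThan complex_norm_square del: of_real_power)

lemma Re_cscalar_prod_commute:
  fixes v w :: "complex vec"
  assumes "v \<in> carrier_vec d" "w \<in> carrier_vec d"
  shows "Re (v \<bullet>c w) = Re (w \<bullet>c v)"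
  using assms by (simp add: scalar_prod_def mult.commute)

lemma cscalar_prod_adjoint:
  fixes M :: "complex mat"
  assumes "M \<in> carrier_mat r c" "v \<in> carrier_vec c" "w \<in> carrier_vec r"
  shows "(M *\<^sub>v v) \<bullet>c w = v \<bullet>c (mat_adjoint M *\<^sub>v w)"
proof -
  have "(M *\<^sub>v v) \<bullet>c w = (\<Sum>i<r. \<Sum>j<c. M $$ (i, j) * v $ j * cnj (w $ i))"
    using assms by (simp add: scalar_prod_def atLeast0LessThan sum_distrib_right)
  also have "\<dots> = (\<Sum>j<c. \<Sum>i<r. M $$ (i, j) * v $ j * cnj (w $ i))"
    by (rule sum.swap)
  also have "\<dots> = v \<bullet>c (mat_adjoint M *\<^sub>v w)"
    using assms mat_adjoint_carrier[OF assms(1)]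
    by (simp add: scalar_prod_def atLeast0LessThan sum_distrib_left mat_adjoint_index[OF assms(1)] ac_simps)
  finally show ?thesis .
qed

text \<open>A crude constant is enough here: it only has to be finite and independent of
  \<open>v\<close>. Each product of two coordinate moduli is at most the squared norm.\<close>

lemma quadratic_form_bound:
  fixes Q :: "complex mat"
  assumes "Q \<in> carrier_mat d d" "v \<in> carrier_vec d"
  shows "Re (v \<bullet>c (Q *\<^sub>v v)) \<le> (\<Sum>i<d. \<Sum>j<d. cmod (Q $$ (i, j))) * Re (v \<bullet>c v)"
proof -
  define N where "N = (\<Sum>i<d. (cmod (v $ i))\<^sup>2)"
  have N: "cmod (v $ i) * cmod (v $ j) \<le> N" if "i < d" "j < d" for i j
  proof -
    have le: "(cmod (v $ k))\<^sup>2 \<le> N" if "k < d" for k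
      unfolding N_def using that by (intro member_le_sum) auto
    have "2 * (cmod (v $ i) * cmod (v $ j)) \<le> (cmod (v $ i))\<^sup>2 + (cmod (v $ j))\<^sup>2"
      using sum_squares_bound[of "cmod (v $ i)" "cmod (v $ j)"] by (simp add: mult.assoc)
    with le[OF that(1)] le[OF that(2)] show ?thesis by linarith
  qed
  have "v \<bullet>c (Q *\<^sub>v v) = (\<Sum>i<d. \<Sum>j<d. v $ i * cnj (Q $$ (i, j) * v $ j))"
    using assms by (simp add: scalar_prod_def atLeast0LessThan sum_distrib_left)
  hence "Re (v \<bullet>c (Q *\<^sub>v v)) \<le> cmod (\<Sum>i<d. \<Sum>j<d. v $ i * cnj (Q $$ (i, j) * v $ j))"
    by (simp only: complex_Re_le_cmod)
  also have "\<dots> \<le> (\<Sum>i<d. \<Sum>j<d. cmod (v $ i * cnj (Q $$ (i, j) * v $ j)))"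
    by (intro order.trans[OF norm_sum] sum_mono order.refl)
  also have "\<dots> \<le> (\<Sum>i<d. \<Sum>j<d. cmod (Q $$ (i, j)) * N)"
  proof (intro sum_mono)
    fix i j assume "i \<in> {..<d}" "j \<in> {..<d}"
    hence "cmod (Q $$ (i, j)) * (cmod (v $ i) * cmod (v $ j)) \<le> cmod (Q $$ (i, j)) * N"
      by (intro mult_left_mono N) auto
    thus "cmod (v $ i * cnj (Q $$ (i, j) * v $ j)) \<le> cmod (Q $$ (i, j)) * N"
      by (simp add: norm_mult ac_simps)
  qed
  also have "\<dots> = (\<Sum>i<d. \<Sum>j<d. cmod (Q $$ (i, j))) * Re (v \<bullet>c v)"
    by (simp add: cscalar_prod_self[OF assms(2)] N_def[symmetric] sum_distrib_right)
  finally show ?thesis .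
qed

text \<open>Let \<open>K u = v\<close>. For real \<open>s\<close>, positivity at
  \<open>v - s u\<close> reads 0 \<le> Re <Kv,v> - 2s|v|^2 + s^2 Re <v,u>, since self-adjointness
  turns <Kv,u> into |v|^2. When Re <v,u> \<le> C|v|^2, taking s = 1/C leaves Re <Kv,v> \<ge>
  |v|^2/C.\<close>

lemma nonsingular_psd_bounded_below:
  fixes K :: "complex mat"
  assumes K: "K \<in> carrier_mat d d" "mat_adjoint K = K" "det K \<noteq> 0"
    and psd: "\<And>v. v \<in> carrier_vec d \<Longrightarrow> 0 \<le> Re ((K *\<^sub>v v) \<bullet>c v)"
  obtains e where "0 < e"
    "\<And>v. v \<in> carrier_vec d \<Longrightarrow> e * Re (v \<bullet>c v) \<le> Re ((K *\<^sub>v v) \<bullet>c v)"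
proof -
  from det_non_zero_imp_unit[OF K(1,3)] obtain Q
    where Q: "Q \<in> carrier_mat d d" "K * Q = 1\<^sub>m d"
    unfolding Units_def by (auto simp: ring_mat_def)
  \<comment> \<open>The sum bounds the quadratic form of the inverse \<open>Q\<close>; adding 1
    makes \<open>C\<close> positive without any case distinction.\<close>
  define C where "C = 1 + (\<Sum>i<d. \<Sum>j<d. cmod (Q $$ (i, j)))"
  have C: "0 < C"
    unfolding C_def by (intro add_pos_nonneg sum_nonneg) auto
  show ?thesis
  proof (rule that[of "1 / C"])
    fix v :: "complex vec" assume v: "v \<in> carrier_vec d"
    define u where "u = Q *\<^sub>v v"
    define s where "s = complex_of_real (1 / C)"
    have u: "u \<in> carrier_vec d" using Q v by (simp add: u_def)
    have Kv: "K *\<^sub>v v \<in> carrier_vec d" using K v by simp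
    have Ku: "K *\<^sub>v u = v"
      using Q K v by (simp add: u_def assoc_mult_mat_vec[of K d d Q d v, symmetric])
    have su: "s \<cdot>\<^sub>v u \<in> carrier_vec d" using u by simp
    have conj: "conjugate (v - s \<cdot>\<^sub>v u) = conjugate v - s \<cdot>\<^sub>v conjugate u"
      using u v by (intro eq_vecI) (auto simp: s_def)
    have cross: "(K *\<^sub>v v) \<bullet>c u = v \<bullet>c v"
      using cscalar_prod_adjoint[OF K(1) v u] K(2) Ku by simp
    have K_diff: "K *\<^sub>v (v - s \<cdot>\<^sub>v u) = K *\<^sub>v v - s \<cdot>\<^sub>v v"
      using mult_minus_distrib_mat_vec[OF K(1) v su] mult_mat_vec[OF K(1) u, of s] Ku by simp
    have "(K *\<^sub>v (v - s \<cdot>\<^sub>v u)) \<bullet>c (v - s \<cdot>\<^sub>v u) =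
        ((K *\<^sub>v v) \<bullet>c v - s * ((K *\<^sub>v v) \<bullet>c u)) - (s * (v \<bullet>c v) - s * (s * (v \<bullet>c u)))"
      unfolding K_diff conj using u v Kv
      by (simp add: minus_scalar_prod_distrib[where n = d] scalar_prod_minus_distrib[where n = d] algebra_simps)
    moreover have "0 \<le> Re ((K *\<^sub>v (v - s \<cdot>\<^sub>v u)) \<bullet>c (v - s \<cdot>\<^sub>v u))"
      using u v by (intro psd) auto
    ultimately have "0 \<le> Re ((K *\<^sub>v v) \<bullet>c v) - 2 * (Re (v \<bullet>c v) / C) + Re (v \<bullet>c u) / C / C"
      unfolding cross by (simp add: s_def)
    moreover have "Re (v \<bullet>c u) / C / C \<le> Re (v \<bullet>c v) / C"
    proof -
      have "0 \<le> Re (v \<bullet>c v)"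
        by (simp add: cscalar_prod_self[OF v] sum_nonneg)
      hence "Re (v \<bullet>c u) \<le> Re (v \<bullet>c v) * C"
        using quadratic_form_bound[OF Q(1) v] by (simp add: u_def C_def algebra_simps)
      thus ?thesis using C by (simp add: divide_right_mono pos_divide_le_eq)
    qed
    ultimately show "1 / C * Re (v \<bullet>c v) \<le> Re ((K *\<^sub>v v) \<bullet>c v)" by simp
  qed (use C in simp)
qed

text \<open>Were the largest lower bound \<open>c\<close> of the Rayleigh quotient not an eigenvalue, \<open>H - c\<close> would
  be a nonsingular positive semidefinite matrix, and \<open>c\<close> could be increased.\<close>

lemma psd_Rayleigh_eigenvalue:
  fixes H :: "complex mat"
  assumes H: "H \<in> carrier_mat d d" "mat_adjoint H = H" and "0 < d"
    and psd: "\<And>v. v \<in> carrier_vec d \<Longrightarrow> 0 \<le> Re ((H *\<^sub>v v) \<bullet>c v)"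
  obtains c where "0 \<le> c" "eigenvalue H (complex_of_real c)"
    "\<And>v. v \<in> carrier_vec d \<Longrightarrow> c * Re (v \<bullet>c v) \<le> Re ((H *\<^sub>v v) \<bullet>c v)"
proof -
  define S where "S = {c. \<forall>v \<in> carrier_vec d. c * Re (v \<bullet>c v) \<le> Re ((H *\<^sub>v v) \<bullet>c v)}"
  define c where "c = Sup S"
  have "0 \<in> S" using psd by (simp add: S_def)
  have unit: "unit_vec d 0 \<bullet>c unit_vec d 0 = (1 :: complex)"
    using \<open>0 < d\<close> by simp
  \<comment> \<open>Testing with one unit vector bounds \<open>S\<close>; such a vector exists
    because \<open>0 < d\<close>.\<close>
  have bdd: "bdd_above S"
  proof (rule bdd_aboveI)
    fix x assume "x \<in> S"
    hence "x * Re (unit_vec d 0 \<bullet>c unit_vec d 0) \<le> Re ((H *\<^sub>v unit_vec d 0) \<bullet>c unit_vec d 0)"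
      unfolding S_def using unit_vec_carrier by blast
    thus "x \<le> Re ((H *\<^sub>v unit_vec d 0) \<bullet>c unit_vec d 0)"
      unfolding unit by simp
  qed
  \<comment> \<open>Each condition defining \<open>S\<close> is closed, so the supremum inherits it:
    divide by |v|^2 when this is positive, and use \<open>psd\<close> otherwise.\<close>
  have "c \<in> S"
    unfolding S_def
  proof safe
    fix v :: "complex vec" assume v: "v \<in> carrier_vec d"
    show "c * Re (v \<bullet>c v) \<le> Re ((H *\<^sub>v v) \<bullet>c v)"
    proof (cases "Re (v \<bullet>c v) = 0")
      case False
      hence N: "0 < Re (v \<bullet>c v)"
        by (simp add: cscalar_prod_self[OF v] sum_nonneg order.not_eq_order_implies_strict)
      have "c \<le> Re ((H *\<^sub>v v) \<bullet>c v) / Re (v \<bullet>c v)"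
        unfolding c_def
      proof (rule cSup_least)
        fix x assume "x \<in> S"
        hence "x * Re (v \<bullet>c v) \<le> Re ((H *\<^sub>v v) \<bullet>c v)" using v by (simp add: S_def)
        thus "x \<le> Re ((H *\<^sub>v v) \<bullet>c v) / Re (v \<bullet>c v)" using N by (simp add: pos_le_divide_eq)
      qed (use \<open>0 \<in> S\<close> in blast)
      thus ?thesis using N by (simp add: pos_le_divide_eq)
    qed (use psd[OF v] in simp)
  qed
  have "0 \<le> c"
    unfolding c_def by (rule cSup_upper[OF \<open>0 \<in> S\<close> bdd])
  have "eigenvalue H (complex_of_real c)"
  proof (rule ccontr)
    \<comment> \<open>\<open>char_matrix H c\<close> is \<open>H\<close> minus \<open>c\<close>
      times the identity, so its determinant vanishes exactly at eigenvalues.\<close>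
    define K where "K = char_matrix H (complex_of_real c)"
    assume "\<not> eigenvalue H (complex_of_real c)"
    hence "det K \<noteq> 0"
      by (simp add: eigenvalue_det[OF H(1)] K_def)
    have K: "K \<in> carrier_mat d d" using H by (simp add: K_def)
    have "mat_adjoint K = K"
    proof (rule eq_matI)
      fix i j assume ij: "i < dim_row K" "j < dim_col K"
      hence ij: "i < d" "j < d" using K by auto
      have "H $$ (i, j) = cnj (H $$ (j, i))"
        using mat_adjoint_index[OF H(1) ij] H(2) by simp
      thus "mat_adjoint K $$ (i, j) = K $$ (i, j)"
        unfolding mat_adjoint_index[OF K ij] using H(1) ij by (auto simp: K_def char_matrix_def)
    qed (use K mat_adjoint_carrier[OF K] in auto)
    have form: "Re ((K *\<^sub>v v) \<bullet>c v) = Re ((H *\<^sub>v v) \<bullet>c v) - c * Re (v \<bullet>c v)"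
      if v: "v \<in> carrier_vec d" for v
    proof -
      have "K *\<^sub>v v = H *\<^sub>v v + (- complex_of_real c) \<cdot>\<^sub>v v"
        using H(1) v by (intro eq_vecI)
          (auto simp: K_def char_matrix_def add_scalar_prod_distrib[where n = d])
      thus ?thesis
        using v H(1) by (simp add: add_scalar_prod_distrib[where n = d])
    qed
    have "0 \<le> Re ((K *\<^sub>v v) \<bullet>c v)" if "v \<in> carrier_vec d" for v
      using form[OF that] \<open>c \<in> S\<close> that by (simp add: S_def)
    from nonsingular_psd_bounded_below[OF K \<open>mat_adjoint K = K\<close> \<open>det K \<noteq> 0\<close> this]
    obtain e where e: "0 < e"
      "\<And>v. v \<in> carrier_vec d \<Longrightarrow> e * Re (v \<bullet>c v) \<le> Re ((K *\<^sub>v v) \<bullet>c v)"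
      by blast
    have "c + e \<in> S"
      unfolding S_def using e(2) form by (force simp: algebra_simps)
    hence "c + e \<le> c"
      unfolding c_def using bdd by (rule cSup_upper)
    thus False using \<open>0 < e\<close> by simp
  qed
  with \<open>0 \<le> c\<close> \<open>c \<in> S\<close> show ?thesis
    by (intro that) (auto simp: S_def)
qed

text \<open>\<open>Min\<close> is known to be a lower bound only for a finite set. The eigenvalues
  are roots of a nonzero polynomial, and squaring is injective on the nonnegative reals.\<close>

lemma finite_singular_values:
  assumes "M \<in> carrier_mat r c"
  shows "finite (singular_values M)"
proof -
  define G where "G = (if dim_row M < dim_col M then M * mat_adjoint M else mat_adjoint M * M)"
  have G: "G \<in> carrier_mat (dim_row G) (dim_row G)"
    using assms mat_adjoint_carrier[OF assms] by (auto simp: G_def)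
  have "char_poly G \<noteq> 0"
    using degree_monic_char_poly[OF G] by auto
  hence "finite {x. eigenvalue G x}"
    by (simp add: eigenvalue_root_char_poly[OF G] poly_roots_finite)
  moreover have "inj_on (\<lambda>s. complex_of_real (s\<^sup>2)) {s. 0 \<le> s}"
    by (intro inj_onI) (simp only: of_real_eq_iff power2_eq_iff_nonneg mem_Collect_eq)
  ultimately have "finite ((\<lambda>s. complex_of_real (s\<^sup>2)) -` {x. eigenvalue G x} \<inter> {s. 0 \<le> s})"
    by (rule finite_vimage_IntI)
  thus ?thesis
    by (rule rev_finite_subset) (auto simp: singular_values_def G_def Let_def)
qed

text \<open>For a self-adjoint \<open>H\<close> the Gram matrix is \<open>H * H\<close>, and an
  eigenvector of \<open>H\<close> for the Rayleigh bound \<open>c\<close> is one of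
  \<open>H * H\<close> for \<open>c^2\<close>. Hence \<open>c\<close> is a singular value, which
  \<open>sigma_min H\<close> cannot exceed.\<close>

lemma sigma_min_le_Rayleigh:
  fixes H :: "complex mat"
  assumes H: "H \<in> carrier_mat d d" "mat_adjoint H = H"
    and psd: "\<And>v. v \<in> carrier_vec d \<Longrightarrow> 0 \<le> Re ((H *\<^sub>v v) \<bullet>c v)"
    and v: "v \<in> carrier_vec d"
  shows "sigma_min H * Re (v \<bullet>c v) \<le> Re ((H *\<^sub>v v) \<bullet>c v)"
proof (cases "d = 0")
  \<comment> \<open>For \<open>d = 0\<close> there are no singular values and
    \<open>sigma_min H\<close> is the minimum of an empty set, but both sides vanish whatever its
    value.\<close>
  case True
  thus ?thesis using v by (simp add: scalar_prod_def)
next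
  case False
  then obtain c where c: "0 \<le> c" "eigenvalue H (complex_of_real c)"
    "\<And>v. v \<in> carrier_vec d \<Longrightarrow> c * Re (v \<bullet>c v) \<le> Re ((H *\<^sub>v v) \<bullet>c v)"
    using psd_Rayleigh_eigenvalue[OF H _ psd] by blast
  from c(2) obtain x where x: "x \<in> carrier_vec d" "x \<noteq> 0\<^sub>v d" "H *\<^sub>v x = complex_of_real c \<cdot>\<^sub>v x"
    using H(1) by (auto simp: eigenvalue_def eigenvector_def)
  have "(H * H) *\<^sub>v x = complex_of_real (c\<^sup>2) \<cdot>\<^sub>v x"
    using H x by (simp add: assoc_mult_mat_vec[where ?n\<^sub>1.0 = d] mult_mat_vec[OF H(1) x(1)]
        smult_smult_assoc power2_eq_square)
  hence "c \<in> singular_values H"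
    using c(1) x H by (auto simp: singular_values_def eigenvalue_def eigenvector_def)
  hence "sigma_min H \<le> c"
    unfolding sigma_min_def by (intro Min_le finite_singular_values[OF H(1)])
  moreover have "0 \<le> Re (v \<bullet>c v)"
    by (simp add: cscalar_prod_self[OF v] sum_nonneg)
  ultimately have "sigma_min H * Re (v \<bullet>c v) \<le> c * Re (v \<bullet>c v)"
    by (rule mult_right_mono)
  also have "\<dots> \<le> Re ((H *\<^sub>v v) \<bullet>c v)"
    by (rule c(3)[OF v])
  finally show ?thesis .
qed

section \<open>Projections and the error of one step\<close>

lemma mat_adjoint_mult:
  fixes M N :: "complex mat"
  assumes "M \<in> carrier_mat a b" "N \<in> carrier_mat b c"
  shows "mat_adjoint (M * N) = mat_adjoint N * mat_adjoint M"
proof (rule eq_matI)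
  have MN: "M * N \<in> carrier_mat a c" using assms by simp
  note adj = mat_adjoint_carrier[OF assms(1)] mat_adjoint_carrier[OF assms(2)] mat_adjoint_carrier[OF MN]
  show "dim_row (mat_adjoint (M * N)) = dim_row (mat_adjoint N * mat_adjoint M)"
    "dim_col (mat_adjoint (M * N)) = dim_col (mat_adjoint N * mat_adjoint M)"
    using adj by auto
  fix i j assume "i < dim_row (mat_adjoint N * mat_adjoint M)" "j < dim_col (mat_adjoint N * mat_adjoint M)"
  hence ij: "i < c" "j < a" using adj by auto
  show "mat_adjoint (M * N) $$ (i, j) = (mat_adjoint N * mat_adjoint M) $$ (i, j)"
    unfolding mat_adjoint_index[OF MN ij]
    using ij adj assms
    by (auto simp: scalar_prod_def mat_adjoint_index[OF assms(1)] mat_adjoint_index[OF assms(2)]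
        intro!: sum.cong)
qed

lemma mat_adjoint_mat_adjoint:
  fixes M :: "complex mat"
  shows "mat_adjoint (mat_adjoint M) = M"
proof -
  have M: "M \<in> carrier_mat (dim_row M) (dim_col M)" by simp
  note M' = mat_adjoint_carrier[OF M]
  show ?thesis
    using mat_adjoint_carrier[OF M']
    by (intro eq_matI) (auto simp: mat_adjoint_index[OF M] mat_adjoint_index[OF M'])
qed

lemma mat_adjoint_one: "mat_adjoint (1\<^sub>m d :: complex mat) = 1\<^sub>m d"
  using mat_adjoint_carrier[OF one_carrier_mat[of d]]
  by (intro eq_matI) (auto simp: mat_adjoint_index[OF one_carrier_mat])

text \<open>\<open>W\<close> inverts a self-adjoint matrix: its adjoint is a left inverse and
  \<open>W\<close> a right inverse, so they agree and \<open>P\<close> is self-adjoint. Idempotence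
  follows from \<open>R * P = R\<close>.\<close>

lemma row_space_projection:
  fixes R W :: "complex mat"
  assumes R: "R \<in> carrier_mat r d" and W: "W \<in> carrier_mat r r"
    and inv: "R * mat_adjoint R * W = 1\<^sub>m r" "W * (R * mat_adjoint R) = 1\<^sub>m r"
  defines "P \<equiv> mat_adjoint R * W * R"
  shows "mat_adjoint P = P" "P * P = P"
proof -
  note R' = mat_adjoint_carrier[OF R] and W' = mat_adjoint_carrier[OF W]
  have G: "R * mat_adjoint R \<in> carrier_mat r r" using R R' by simp
  have G': "mat_adjoint (R * mat_adjoint R) = R * mat_adjoint R"
    using mat_adjoint_mult[OF R R'] by (simp add: mat_adjoint_mat_adjoint)
  have "mat_adjoint W * (R * mat_adjoint R) = 1\<^sub>m r"
    using mat_adjoint_mult[OF G W] inv(1) G' by (simp add: mat_adjoint_one)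
  hence "mat_adjoint W = W"
    using assoc_mult_mat[OF W' G W] inv(1) W W' by simp
  thus "mat_adjoint P = P"
    using mat_adjoint_mult[OF mult_carrier_mat[OF R' W] R] mat_adjoint_mult[OF R' W]
      assoc_mult_mat[OF R' W R]
    by (simp add: P_def mat_adjoint_mat_adjoint)
  have RW: "mat_adjoint R * W \<in> carrier_mat d r" and "P \<in> carrier_mat d d"
    using R R' W by (simp_all add: P_def)
  have "R * P = R * mat_adjoint R * W * R"
    unfolding P_def assoc_mult_mat[OF R RW R, symmetric] assoc_mult_mat[OF R R' W, symmetric] ..
  hence "R * P = R"
    using R by (simp add: inv(1))
  thus "P * P = P"
    using assoc_mult_mat[OF RW R \<open>P \<in> carrier_mat d d\<close>] by (simp add: P_def)
qed

text \<open>Self-adjointness and idempotence give <Pv,v> = |Pv|^2 in real part, whence positivity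
  and the Pythagorean identity.\<close>

lemma orthogonal_projection_form:
  fixes P :: "complex mat"
  assumes P: "P \<in> carrier_mat d d" "mat_adjoint P = P" "P * P = P" and v: "v \<in> carrier_vec d"
  shows "0 \<le> Re ((P *\<^sub>v v) \<bullet>c v)"
    and "Re ((v - P *\<^sub>v v) \<bullet>c (v - P *\<^sub>v v)) = Re (v \<bullet>c v) - Re ((P *\<^sub>v v) \<bullet>c v)"
proof -
  have Pv: "P *\<^sub>v v \<in> carrier_vec d" using P v by simp
  have "(P *\<^sub>v v) \<bullet>c (P *\<^sub>v v) = v \<bullet>c (P *\<^sub>v v)"
    using cscalar_prod_adjoint[OF P(1) v Pv] P assoc_mult_mat_vec[OF P(1) P(1) v] by simp
  hence eq: "Re ((P *\<^sub>v v) \<bullet>c (P *\<^sub>v v)) = Re ((P *\<^sub>v v) \<bullet>c v)"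
    using Re_cscalar_prod_commute[OF v Pv] by simp
  show "0 \<le> Re ((P *\<^sub>v v) \<bullet>c v)"
    unfolding eq[symmetric] by (simp add: cscalar_prod_self[OF Pv] sum_nonneg)
  have conj: "conjugate (v - P *\<^sub>v v) = conjugate v - conjugate (P *\<^sub>v v)"
    using v Pv P by (intro eq_vecI) auto
  show "Re ((v - P *\<^sub>v v) \<bullet>c (v - P *\<^sub>v v)) = Re (v \<bullet>c v) - Re ((P *\<^sub>v v) \<bullet>c v)"
    unfolding conj using v Pv eq Re_cscalar_prod_commute[OF v Pv]
    by (simp add: minus_scalar_prod_distrib[where n = d] scalar_prod_minus_distrib[where n = d])
qed

section \<open>Averages of orthogonal projections\<close>

lemma expectation_mat_carrier: "expectation_mat D nr nc F \<in> carrier_mat nr nc"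
  by (simp add: expectation_mat_def)

lemma expectation_mat_index:
  assumes "set_pmf D \<subseteq> {..<m}" "r < nr" "c < nc"
  shows "expectation_mat D nr nc F $$ (r, c) = (\<Sum>i<m. complex_of_real (pmf D i) * F i $$ (r, c))"
proof -
  have "measure_pmf.expectation D (\<lambda>i. F i $$ (r, c)) = (\<Sum>i<m. pmf D i *\<^sub>R F i $$ (r, c))"
    using assms(1) by (intro integral_measure_pmf) auto
  thus ?thesis
    using assms(2,3) by (simp add: expectation_mat_def scaleR_conv_of_real)
qed

lemma expectation_mat_adjoint:
  assumes "set_pmf D \<subseteq> {..<m}"
    and "\<And>i. i < m \<Longrightarrow> F i \<in> carrier_mat d d" "\<And>i. i < m \<Longrightarrow> mat_adjoint (F i) = F i"
  shows "mat_adjoint (expectation_mat D d d F) = expectation_mat D d d F"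
proof -
  note E = expectation_mat_carrier[of D d d F]
  show ?thesis
  proof (rule eq_matI)
    fix r c assume "r < dim_row (expectation_mat D d d F)" "c < dim_col (expectation_mat D d d F)"
    hence rc: "r < d" "c < d" using E by auto
    have "cnj (F i $$ (c, r)) = F i $$ (r, c)" if "i < m" for i
      using mat_adjoint_index[OF assms(2)[OF that] rc] assms(3)[OF that] by simp
    thus "mat_adjoint (expectation_mat D d d F) $$ (r, c) = expectation_mat D d d F $$ (r, c)"
      using rc by (simp add: mat_adjoint_index[OF E] expectation_mat_index[OF assms(1)])
  qed (use E mat_adjoint_carrier[OF E] in auto)
qed

lemma expectation_mat_form:
  assumes "set_pmf D \<subseteq> {..<m}" "\<And>i. i < m \<Longrightarrow> F i \<in> carrier_mat d d" "v \<in> carrier_vec d"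
  shows "Re ((expectation_mat D d d F *\<^sub>v v) \<bullet>c v) = (\<Sum>i<m. pmf D i * Re ((F i *\<^sub>v v) \<bullet>c v))"
proof -
  have form: "(M *\<^sub>v v) \<bullet>c v = (\<Sum>r<d. \<Sum>c<d. M $$ (r, c) * v $ c * cnj (v $ r))"
    if "M \<in> carrier_mat d d" for M
    using assms(3) that by (simp add: scalar_prod_def atLeast0LessThan sum_distrib_right)
  have "(expectation_mat D d d F *\<^sub>v v) \<bullet>c v =
      (\<Sum>r<d. \<Sum>c<d. \<Sum>i<m. complex_of_real (pmf D i) * (F i $$ (r, c) * v $ c * cnj (v $ r)))"
    by (simp add: form[OF expectation_mat_carrier] expectation_mat_index[OF assms(1)] sum_distrib_right
        mult.assoc)
  also have "\<dots> = (\<Sum>r<d. \<Sum>i<m. \<Sum>c<d. complex_of_real (pmf D i) * (F i $$ (r, c) * v $ c * cnj (v $ r)))"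
    by (intro sum.cong refl sum.swap)
  also have "\<dots> = (\<Sum>i<m. \<Sum>r<d. \<Sum>c<d. complex_of_real (pmf D i) * (F i $$ (r, c) * v $ c * cnj (v $ r)))"
    by (rule sum.swap)
  also have "\<dots> = (\<Sum>i<m. complex_of_real (pmf D i) * ((F i *\<^sub>v v) \<bullet>c v))"
    by (simp add: form[OF assms(2)] sum_distrib_left)
  finally show ?thesis by simp
qed

text \<open>Averaging the Pythagorean identity with weights of total mass 1 leaves |v|^2 minus the
  quadratic form of the mean matrix, to which the Rayleigh bound applies.\<close>

lemma expected_residual_le:
  assumes D: "set_pmf D \<subseteq> {..<m}"
    and F: "\<And>i. i < m \<Longrightarrow> F i \<in> carrier_mat d d" "\<And>i. i < m \<Longrightarrow> mat_adjoint (F i) = F i"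
      "\<And>i. i < m \<Longrightarrow> F i * F i = F i"
    and v: "v \<in> carrier_vec d"
  shows "(\<Sum>i<m. pmf D i * Re ((v - F i *\<^sub>v v) \<bullet>c (v - F i *\<^sub>v v)))
    \<le> (1 - sigma_min (expectation_mat D d d F)) * Re (v \<bullet>c v)"
proof -
  define H where "H = expectation_mat D d d F"
  have H: "H \<in> carrier_mat d d" "mat_adjoint H = H"
    using expectation_mat_carrier expectation_mat_adjoint[OF D F(1,2)] by (simp_all add: H_def)
  have form: "Re ((H *\<^sub>v w) \<bullet>c w) = (\<Sum>i<m. pmf D i * Re ((F i *\<^sub>v w) \<bullet>c w))"
    if "w \<in> carrier_vec d" for w
    unfolding H_def by (rule expectation_mat_form[OF D F(1) that])
  have "0 \<le> Re ((H *\<^sub>v w) \<bullet>c w)" if "w \<in> carrier_vec d" for w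
    unfolding form[OF that]
    by (intro sum_nonneg mult_nonneg_nonneg orthogonal_projection_form(1)[OF F that]) auto
  from sigma_min_le_Rayleigh[OF H this v]
  have le: "sigma_min H * Re (v \<bullet>c v) \<le> Re ((H *\<^sub>v v) \<bullet>c v)" .
  have one: "(\<Sum>i<m. pmf D i) = 1"
    using D by (intro sum_pmf_eq_1) auto
  have "(\<Sum>i<m. pmf D i * Re ((v - F i *\<^sub>v v) \<bullet>c (v - F i *\<^sub>v v))) =
      (\<Sum>i<m. pmf D i * (Re (v \<bullet>c v) - Re ((F i *\<^sub>v v) \<bullet>c v)))"
    using orthogonal_projection_form(2)[OF F v] by simp
  also have "\<dots> = Re (v \<bullet>c v) - Re ((H *\<^sub>v v) \<bullet>c v)"
    by (simp add: form[OF v] right_diff_distrib sum_subtractf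
        sum_distrib_right[symmetric] one)
  finally show ?thesis
    using le by (simp add: H_def algebra_simps)
qed

section \<open>Tensor inverses, row projections and one Kaczmarz step\<close>

lemma is_tinverse_iff_bcirc:
  assumes "T \<in> carrier_tensor m m n" "0 < n"
  shows "is_tinverse T S \<longleftrightarrow> S \<in> carrier_tensor m m n \<and>
    bcirc T * bcirc S = 1\<^sub>m (m * n) \<and> bcirc S * bcirc T = 1\<^sub>m (m * n)"
proof -
  have "V = tone m n \<longleftrightarrow> bcirc V = 1\<^sub>m (m * n)" if "V \<in> carrier_tensor m m n" for V
    using bcirc_inject[OF that tone_carrier] bcirc_tone[OF assms(2)] by metis
  note eq = this[OF tprod_carrier[OF assms(1) _ assms(2)]] this[OF tprod_carrier[OF _ assms]]
  have "is_tinverse T S \<longleftrightarrow> S \<in> carrier_tensor m m n \<and> T *\<^sub>t S = tone m n \<and> S *\<^sub>t T = tone m n"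
    using assms by (simp add: is_tinverse_def Let_def tensor_dims carrier_tensorD(1))
  thus ?thesis
    using eq assms by (auto simp: bcirc_tprod)
qed

text \<open>\<open>tinverse\<close> is a definite description, so uniqueness has to come first. It
  is read off from associativity of matrix products and injectivity of \<open>bcirc\<close>, without
  associativity of the t-product.\<close>

lemma tinverse_bcirc:
  assumes T: "T \<in> carrier_tensor m m n" "0 < n" and "tinvertible T"
  shows "tinverse T \<in> carrier_tensor m m n"
    "bcirc T * bcirc (tinverse T) = 1\<^sub>m (m * n)" "bcirc (tinverse T) * bcirc T = 1\<^sub>m (m * n)"
proof -
  note iff = is_tinverse_iff_bcirc[OF T]
  have unique: "S = S'" if "is_tinverse T S" "is_tinverse T S'" for S S'
  proof (rule bcirc_inject)
    show S: "S \<in> carrier_tensor m m n" "S' \<in> carrier_tensor m m n"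
      using that iff by auto
    note b = bcirc_carrier[OF S(1) T(2)] bcirc_carrier[OF S(2) T(2)] bcirc_carrier[OF T]
    show "bcirc S = bcirc S'"
      using assoc_mult_mat[OF b(1,3,2)] that b unfolding iff by simp
  qed
  from \<open>tinvertible T\<close> unique have "\<exists>!S. is_tinverse T S"
    unfolding tinvertible_def by blast
  hence "is_tinverse T (tinverse T)"
    unfolding tinverse_def by (rule theI')
  thus "tinverse T \<in> carrier_tensor m m n"
    "bcirc T * bcirc (tinverse T) = 1\<^sub>m (m * n)" "bcirc (tinverse T) * bcirc T = 1\<^sub>m (m * n)"
    unfolding iff by simp_all
qed

lemma row_projection_orthogonal:
  assumes A: "A \<in> carrier_tensor m l n" and n: "0 < n"
    and inv: "tinvertible (row_slice A i *\<^sub>t tadjoint (row_slice A i))"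
  shows "row_projection A i \<in> carrier_tensor l l n"
    "mat_adjoint (bcirc (row_projection A i)) = bcirc (row_projection A i)"
    "bcirc (row_projection A i) * bcirc (row_projection A i) = bcirc (row_projection A i)"
proof -
  define R where "R = row_slice A i"
  have R: "R \<in> carrier_tensor 1 l n"
    unfolding R_def by (rule row_slice_carrier[OF A])
  note R' = tadjoint_carrier[OF R]
  note G = tprod_carrier[OF R R' n]
  note W = tinverse_bcirc[OF G n inv[folded R_def]]
  note RW = tprod_carrier[OF R' W(1) n]
  have P: "row_projection A i = tadjoint R *\<^sub>t tinverse (R *\<^sub>t tadjoint R) *\<^sub>t R"
    by (simp add: row_projection_def R_def Let_def)
  show "row_projection A i \<in> carrier_tensor l l n"
    unfolding P by (rule tprod_carrier[OF RW R n])
  have bG: "bcirc (R *\<^sub>t tadjoint R) = bcirc R * mat_adjoint (bcirc R)"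
    by (simp add: bcirc_tprod[OF R R' n] bcirc_tadjoint[OF R n])
  have bP: "bcirc (row_projection A i) =
      mat_adjoint (bcirc R) * bcirc (tinverse (R *\<^sub>t tadjoint R)) * bcirc R"
    unfolding P by (simp add: bcirc_tprod[OF RW R n] bcirc_tprod[OF R' W(1) n] bcirc_tadjoint[OF R n])
  note proj = row_space_projection[OF bcirc_carrier[OF R n] bcirc_carrier[OF W(1) n] W(2,3)[unfolded bG]]
  show "mat_adjoint (bcirc (row_projection A i)) = bcirc (row_projection A i)"
    "bcirc (row_projection A i) * bcirc (row_projection A i) = bcirc (row_projection A i)"
    unfolding bP by (fact proj(1), fact proj(2))
qed

text \<open>The right-hand side is \<open>A *\<^sub>t S\<close>, so the residual of the sampled row
  is that row applied to the error \<open>X - S\<close>. The step thus acts linearly on the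
  error.\<close>

lemma kaczmarz_step_error:
  assumes A: "A \<in> carrier_tensor m l n" and n: "0 < n" and i: "i < m"
    and inv: "tinvertible (row_slice A i *\<^sub>t tadjoint (row_slice A i))"
    and X: "X \<in> carrier_tensor l p n" and S: "S \<in> carrier_tensor l p n"
  defines "R \<equiv> row_slice A i"
  defines "X' \<equiv> X -\<^sub>t tadjoint R *\<^sub>t tinverse (R *\<^sub>t tadjoint R) *\<^sub>t (R *\<^sub>t X -\<^sub>t row_slice (A *\<^sub>t S) i)"
  shows "X' \<in> carrier_tensor l p n"
    "tunfold (X' -\<^sub>t S) = tunfold (X -\<^sub>t S) - bcirc (row_projection A i) * tunfold (X -\<^sub>t S)"
proof -
  have R: "R \<in> carrier_tensor 1 l n"
    unfolding R_def by (rule row_slice_carrier[OF A])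
  note R' = tadjoint_carrier[OF R]
  note G = tprod_carrier[OF R R' n]
  note W = tinverse_bcirc[OF G n inv[folded R_def]]
  note RW = tprod_carrier[OF R' W(1) n]
  note RX = tprod_carrier[OF R X n] and RS = tprod_carrier[OF R S n]
  note res = tminus_carrier[OF RX RS]
  note step = tprod_carrier[OF RW res n]
  have X': "X' = X -\<^sub>t tadjoint R *\<^sub>t tinverse (R *\<^sub>t tadjoint R) *\<^sub>t (R *\<^sub>t X -\<^sub>t R *\<^sub>t S)"
    unfolding X'_def R_def row_slice_tprod[OF A S n i] ..
  show carr: "X' \<in> carrier_tensor l p n"
    unfolding X' by (rule tminus_carrier[OF X step])
  define x where "x = tunfold X"
  define s where "s = tunfold S"
  \<comment> \<open>Products associate to the left, so this prefix of the correction term is also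
    the prefix of \<open>row_projection A i\<close>.\<close>
  define Q where "Q = bcirc (tadjoint R *\<^sub>t tinverse (R *\<^sub>t tadjoint R))"
  have carr': "x \<in> carrier_mat (l * n) p" "s \<in> carrier_mat (l * n) p"
      "Q \<in> carrier_mat (l * n) (1 * n)" "bcirc R \<in> carrier_mat (1 * n) (l * n)"
    unfolding x_def s_def Q_def
    using tunfold_carrier[OF X n] tunfold_carrier[OF S n] bcirc_carrier[OF RW n] bcirc_carrier[OF R n] by auto
  have P: "bcirc (row_projection A i) = Q * bcirc R"
    by (simp add: row_projection_def R_def[symmetric] Let_def bcirc_tprod[OF RW R n] Q_def)
  have "tunfold (X' -\<^sub>t S) = x - Q * (bcirc R * x - bcirc R * s) - s"
    unfolding tunfold_tminus[OF carr S n] unfolding X' tunfold_tminus[OF X step n]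
      tunfold_tprod[OF RW res n] tunfold_tminus[OF RX RS n] tunfold_tprod[OF R X n] tunfold_tprod[OF R S n]
    by (simp only: x_def s_def Q_def)
  also have "bcirc R * x - bcirc R * s = bcirc R * (x - s)"
    using mult_minus_distrib_mat[OF carr'(4,1,2)] by simp
  also have "Q * (bcirc R * (x - s)) = Q * bcirc R * (x - s)"
    using assoc_mult_mat[OF carr'(3,4)] minus_carrier_mat[OF carr'(2)] by metis
  also have "x - Q * bcirc R * (x - s) - s = (x - s) - Q * bcirc R * (x - s)"
    using carr' by (intro eq_matI) auto
  finally show "tunfold (X' -\<^sub>t S) = tunfold (X -\<^sub>t S) - bcirc (row_projection A i) * tunfold (X -\<^sub>t S)"
    unfolding tunfold_tminus[OF X S n] P by (simp only: x_def s_def)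
qed

lemma frob_sq_columns:
  assumes "T \<in> carrier_tensor l p n" "0 < n"
  shows "frob_sq T = (\<Sum>j<p. Re (col (tunfold T) j \<bullet>c col (tunfold T) j))"
proof -
  note T = tunfold_carrier[OF assms]
  have col: "col (tunfold T) j \<in> carrier_vec (l * n)" for j
    using T by (intro carrier_vecI) simp
  show ?thesis
    using T by (simp add: frob_sq_tunfold[OF assms] cscalar_prod_self[OF col])
qed

lemma frob_sq_nonneg: "0 \<le> frob_sq T"
  unfolding frob_sq_def by (intro sum_list_nonneg) (auto intro!: sum_nonneg)

text \<open>The squared Frobenius norm is the sum of the squared norms of the columns of the
  unfolding. The projections act on each column separately, so the vector estimate is summed over
  columns.\<close>

lemma expected_kaczmarz_step_le:
  assumes A: "A \<in> carrier_tensor m l n" and n: "0 < n"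
    and inv: "\<And>i. i < m \<Longrightarrow> tinvertible (row_slice A i *\<^sub>t tadjoint (row_slice A i))"
    and D: "set_pmf D \<subseteq> {..<m}"
    and Z: "Z \<in> carrier_tensor l p n"
    and Z': "\<And>i. i < m \<Longrightarrow> Z' i \<in> carrier_tensor l p n"
      "\<And>i. i < m \<Longrightarrow> tunfold (Z' i) = tunfold Z - bcirc (row_projection A i) * tunfold Z"
  shows "(\<Sum>i<m. pmf D i * frob_sq (Z' i)) \<le>
    (1 - sigma_min (expectation_mat D (l * n) (l * n) (\<lambda>i. bcirc (row_projection A i)))) * frob_sq Z"
proof -
  define F where "F i = bcirc (row_projection A i)" for i
  note proj = row_projection_orthogonal[OF A n inv]
  have F: "F i \<in> carrier_mat (l * n) (l * n)" "mat_adjoint (F i) = F i" "F i * F i = F i" if "i < m" for i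
    using bcirc_carrier[OF proj(1) n] proj(2,3) that by (simp_all add: F_def)
  define z where "z j = col (tunfold Z) j" for j
  have U: "tunfold Z \<in> carrier_mat (l * n) p" by (rule tunfold_carrier[OF Z n])
  have z: "z j \<in> carrier_vec (l * n)" for j
    using U by (intro carrier_vecI) (simp add: z_def)
  have col: "col (tunfold (Z' i)) j = z j - F i *\<^sub>v z j" if "i < m" "j < p" for i j
    using that U F(1)[OF that(1)] by (intro eq_vecI) (auto simp: Z'(2) z_def F_def)
  have "(\<Sum>i<m. pmf D i * frob_sq (Z' i)) =
      (\<Sum>i<m. \<Sum>j<p. pmf D i * Re ((z j - F i *\<^sub>v z j) \<bullet>c (z j - F i *\<^sub>v z j)))"
    by (simp add: frob_sq_columns[OF Z'(1) n] col sum_distrib_left)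
  also have "\<dots> = (\<Sum>j<p. \<Sum>i<m. pmf D i * Re ((z j - F i *\<^sub>v z j) \<bullet>c (z j - F i *\<^sub>v z j)))"
    by (rule sum.swap)
  also have "\<dots> \<le> (\<Sum>j<p. (1 - sigma_min (expectation_mat D (l * n) (l * n) F)) * Re (z j \<bullet>c z j))"
    by (intro sum_mono expected_residual_le[OF D F z])
  also have "\<dots> = (1 - sigma_min (expectation_mat D (l * n) (l * n) F)) * frob_sq Z"
    by (simp add: frob_sq_columns[OF Z n] z_def sum_distrib_left)
  finally show ?thesis
    unfolding F_def .
qed

section \<open>Averaging over the sampled indices\<close>

text \<open>An iterate depends only on the indices drawn before it. This permits altering the next
  index while the past is held fixed, and makes the error a function of a finite prefix.\<close>

lemma kaczmarz_cong:
  assumes "\<And>s. s < t \<Longrightarrow> a s = b s"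
  shows "kaczmarz A B X0 a t = kaczmarz A B X0 b t"
  using assms by (induction t) (simp_all add: Let_def)

lemma sum_PiE_lessThan_Suc:
  fixes f :: "(nat \<Rightarrow> 'a) \<Rightarrow> 'b :: comm_monoid_add"
  shows "(\<Sum>a \<in> PiE {..<Suc t} (\<lambda>_. S). f a) = (\<Sum>a \<in> PiE {..<t} (\<lambda>_. S). \<Sum>i\<in>S. f (a(t := i)))"
proof -
  have "(\<Sum>a \<in> PiE {..<Suc t} (\<lambda>_. S). f a) =
      (\<Sum>x \<in> S \<times> PiE {..<t} (\<lambda>_. S). f (case x of (i, a) \<Rightarrow> a(t := i)))"
    unfolding lessThan_Suc PiE_insert_eq
    by (subst sum.reindex) (auto intro: inj_combinator)
  also have "\<dots> = (\<Sum>i\<in>S. \<Sum>a \<in> PiE {..<t} (\<lambda>_. S). f (a(t := i)))"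
    by (simp add: sum.cartesian_product split_def)
  also have "\<dots> = (\<Sum>a \<in> PiE {..<t} (\<lambda>_. S). \<Sum>i\<in>S. f (a(t := i)))"
    by (rule sum.swap)
  finally show ?thesis .
qed

text \<open>Almost surely the first \<open>t\<close> indices form one of finitely many words over
  \<open>S\<close>. The integrand is then a finite combination of indicators of cylinder events,
  whose probabilities factor by independence.\<close>

lemma (in prob_space) expectation_iid_prefix:
  fixes I :: "nat \<Rightarrow> 'a \<Rightarrow> nat" and f :: "(nat \<Rightarrow> nat) \<Rightarrow> real"
  assumes indep: "indep_vars (\<lambda>_. count_space UNIV) I UNIV"
    and distr: "\<And>s. distr M (count_space UNIV) (I s) = measure_pmf D"
    and S: "set_pmf D \<subseteq> S" "finite S"
    and f: "\<And>a b. (\<And>s. s < t \<Longrightarrow> a s = b s) \<Longrightarrow> f a = f b"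
  shows "expectation (\<lambda>w. f (\<lambda>s. I s w)) = (\<Sum>a \<in> PiE {..<t} (\<lambda>_. S). (\<Prod>s<t. pmf D (a s)) * f a)"
proof -
  have I [measurable]: "random_variable (count_space UNIV) (I s)" for s
    using indep by (simp add: indep_vars_def)
  define E where "E a = {w \<in> space M. \<forall>s<t. I s w = a s}" for a
  have E [measurable]: "E a \<in> events" for a
    unfolding E_def by measurable
  have prob_E: "prob (E a) = (\<Prod>s<t. pmf D (a s))" for a
  \<comment> \<open>An empty prefix imposes no condition, so the event is the whole space; the
    product rule for independent variables is applied to a nonempty index set only.\<close>
  proof (cases "t = 0")
    case False
    have "prob (E a) = prob (\<Inter>s\<in>{..<t}. I s -` {a s} \<inter> space M)"
      using False by (intro arg_cong[of _ _ prob]) (auto simp: E_def)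
    also have "\<dots> = (\<Prod>s<t. prob (I s -` {a s} \<inter> space M))"
      using False by (intro indep_varsD[OF indep]) auto
    also have "\<dots> = (\<Prod>s<t. pmf D (a s))"
      by (simp add: measure_distr[OF I, symmetric] distr measure_pmf_single)
    finally show ?thesis .
  qed (simp add: E_def prob_space)
  \<comment> \<open>Nothing is assumed about measurability of \<open>f\<close>. It factors through
    the restriction to a finite prefix, whose values lie in a finite product of countable discrete
    spaces, again discrete.\<close>
  have meas: "(\<lambda>w. f (\<lambda>s. I s w)) \<in> borel_measurable M"
  proof -
    have "(\<lambda>w. restrict (\<lambda>s. I s w) {..<t}) \<in> measurable M (PiM {..<t} (\<lambda>_. count_space UNIV))"
      by (intro measurable_restrict I)
    hence "(\<lambda>w. restrict (\<lambda>s. I s w) {..<t}) \<in> measurable M (count_space (PiE {..<t} (\<lambda>_. UNIV)))"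
      by (simp add: count_space_PiM_finite)
    hence "(\<lambda>w. f (restrict (\<lambda>s. I s w) {..<t})) \<in> borel_measurable M"
      by (rule measurable_compose) simp
    moreover have "f (restrict (\<lambda>s. I s w) {..<t}) = f (\<lambda>s. I s w)" for w
      by (rule f) simp
    ultimately show ?thesis by simp
  qed
  have "AE w in M. I s w \<in> S" for s
  proof (rule AE_distrD[OF I])
    show "AE i in distr M (count_space UNIV) (I s). i \<in> S"
      using S(1) unfolding distr by (auto simp: AE_measure_pmf_iff)
  qed
  hence "AE w in M. \<forall>s. I s w \<in> S"
    by (simp add: AE_all_countable)
  hence "AE w in M. f (\<lambda>s. I s w) = (\<Sum>a \<in> PiE {..<t} (\<lambda>_. S). indicator (E a) w * f a)"
    using AE_space
  proof eventually_elim
    case (elim w)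
    \<comment> \<open>Words in \<open>PiE\<close> are undefined beyond position \<open>t\<close>, so
      the sample path must be restricted; exactly this one word then contributes to the sum.\<close>
    define b where "b = restrict (\<lambda>s. I s w) {..<t}"
    have b: "b \<in> PiE {..<t} (\<lambda>_. S)" using elim by (auto simp: b_def)
    have "w \<in> E a \<longleftrightarrow> a = b" if "a \<in> PiE {..<t} (\<lambda>_. S)" for a
    proof
      assume "w \<in> E a"
      thus "a = b"
        by (intro PiE_ext[OF that b]) (simp add: E_def b_def)
    next
      assume "a = b"
      thus "w \<in> E a"
        using elim(2) by (simp add: E_def b_def)
    qed
    hence "(\<Sum>a \<in> PiE {..<t} (\<lambda>_. S). indicator (E a) w * f a) =
        (\<Sum>a \<in> PiE {..<t} (\<lambda>_. S). if a = b then f a else 0)"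
      by (intro sum.cong) (auto simp: indicator_def)
    also have "\<dots> = f b"
      using b S(2) by (simp add: finite_PiE)
    also have "\<dots> = f (\<lambda>s. I s w)"
      by (rule f) (simp add: b_def)
    finally show ?case ..
  qed
  hence "expectation (\<lambda>w. f (\<lambda>s. I s w)) =
      expectation (\<lambda>w. \<Sum>a \<in> PiE {..<t} (\<lambda>_. S). indicator (E a) w * f a)"
    using meas by (intro integral_cong_AE) auto
  also have "\<dots> = (\<Sum>a \<in> PiE {..<t} (\<lambda>_. S). prob (E a) * f a)"
    by (subst Bochner_Integration.integral_sum) (auto simp: emeasure_eq_measure)
  finally show ?thesis
    by (simp add: prob_E)
qed

text \<open>Conditioning on the initial iterate is expressed by keeping \<open>X0\<close>
  deterministic, while the indices live on an arbitrary probability space \<open>M\<close>.\<close>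

theorem theorem6:
  fixes m l n p :: nat
    and A B X_sol X0 :: tensor
    and D :: "nat pmf"
    and M :: "'w measure"
    and I :: "nat \<Rightarrow> 'w \<Rightarrow> nat"
  assumes "0 < n"
    and "A \<in> carrier_tensor m l n"
    and "\<And>i. i < m \<Longrightarrow> tinvertible (row_slice A i *\<^sub>t tadjoint (row_slice A i))"
    and "B \<in> carrier_tensor m p n"
    and "X_sol \<in> carrier_tensor l p n"
    and "A *\<^sub>t X_sol = B"
    and "set_pmf D \<subseteq> {..<m}"
    and "prob_space M"
    and "prob_space.indep_vars M (\<lambda>_. count_space UNIV) I UNIV"
    and "\<And>s. distr M (count_space UNIV) (I s) = measure_pmf D"
    and "X0 \<in> carrier_tensor l p n"
  shows "\<forall>t. prob_space.expectation M
               (\<lambda>w. frob_sq (kaczmarz A B X0 (\<lambda>s. I s w) (t + 1) -\<^sub>t X_sol))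
             \<le> (1 - sigma_min (expectation_mat D (l * n) (l * n) (\<lambda>i. bcirc (row_projection A i)))) ^ (t + 1)
               * frob_sq (X0 -\<^sub>t X_sol)"
proof -
  interpret prob_space M by fact
  define q where "q = 1 - sigma_min (expectation_mat D (l * n) (l * n) (\<lambda>i. bcirc (row_projection A i)))"
  define err where "err t a = frob_sq (kaczmarz A B X0 a t -\<^sub>t X_sol)" for t a
  \<comment> \<open>This is the expected error after \<open>t\<close> steps as a sum over index
    words; the identification with the integral over \<open>M\<close> is made only at the
    end.\<close>
  define e where "e t = (\<Sum>a \<in> PiE {..<t} (\<lambda>_. {..<m}). (\<Prod>s<t. pmf D (a s)) * err t a)" for t
  note A = \<open>A \<in> carrier_tensor m l n\<close> and n = \<open>0 < n\<close> and inv = assms(3)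
    and sol = \<open>X_sol \<in> carrier_tensor l p n\<close> and D = \<open>set_pmf D \<subseteq> {..<m}\<close>
  have B: "B = A *\<^sub>t X_sol" using assms(6) ..
  note step = kaczmarz_step_error[OF A n _ inv _ sol, folded B]
  have carrier: "kaczmarz A B X0 a t \<in> carrier_tensor l p n" if "\<And>s. s < t \<Longrightarrow> a s < m" for a t
    using that by (induction t) (auto simp: Let_def intro: assms(11) step(1))
  \<comment> \<open>Here the past word \<open>a\<close> is frozen and only the index at position
    \<open>t\<close> is averaged, which replaces a conditional expectation.\<close>
  have contract: "(\<Sum>i<m. pmf D i * err (Suc t) (a(t := i))) \<le> q * err t a"
    if "a \<in> PiE {..<t} (\<lambda>_. {..<m})" for a t
  proof -
    have a: "a s < m" if "s < t" for s
      using \<open>a \<in> _\<close> that by auto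
    define X where "X = kaczmarz A B X0 a t"
    have X: "X \<in> carrier_tensor l p n"
      unfolding X_def using a by (rule carrier)
    define X' where "X' i = kaczmarz A B X0 (a(t := i)) (Suc t)" for i
    have X': "X' i \<in> carrier_tensor l p n" if "i < m" for i
      unfolding X'_def using a that by (intro carrier) (auto simp: less_Suc_eq)
    have "kaczmarz A B X0 (a(t := i)) t = X" for i
      unfolding X_def by (rule kaczmarz_cong) simp
    hence X'_eq: "X' i = X -\<^sub>t tadjoint (row_slice A i) *\<^sub>t
        tinverse (row_slice A i *\<^sub>t tadjoint (row_slice A i)) *\<^sub>t (row_slice A i *\<^sub>t X -\<^sub>t row_slice B i)" for i
      by (simp add: X'_def Let_def)
    show ?thesis
      unfolding q_def err_def X_def[symmetric] X'_def[symmetric]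
      using step(2)[OF _ _ X]
      by (intro expected_kaczmarz_step_le[OF A n inv D tminus_carrier[OF X sol]] tminus_carrier X' sol)
         (simp_all add: X'_eq)
  qed
  have e_nonneg: "0 \<le> e t" for t
    unfolding e_def err_def by (intro sum_nonneg mult_nonneg_nonneg prod_nonneg frob_sq_nonneg) auto
  have e_Suc: "e (Suc t) \<le> q * e t" for t
  proof -
    have "e (Suc t) = (\<Sum>a \<in> PiE {..<t} (\<lambda>_. {..<m}). (\<Prod>s<t. pmf D (a s)) *
        (\<Sum>i<m. pmf D i * err (Suc t) (a(t := i))))"
      unfolding e_def sum_PiE_lessThan_Suc
      by (simp add: sum_distrib_left mult.assoc)
    also have "\<dots> \<le> (\<Sum>a \<in> PiE {..<t} (\<lambda>_. {..<m}). (\<Prod>s<t. pmf D (a s)) * (q * err t a))"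
      by (intro sum_mono mult_left_mono contract prod_nonneg) auto
    also have "\<dots> = q * e t"
      by (simp add: e_def sum_distrib_left ac_simps)
    finally show ?thesis .
  qed
  have pow: "e t \<le> q ^ t * e 0" if "0 \<le> q" for t
  proof (induction t)
    case (Suc t)
    have "e (Suc t) \<le> q * e t" by (rule e_Suc)
    also have "\<dots> \<le> q * (q ^ t * e 0)" using Suc that by (rule mult_left_mono)
    finally show ?case by simp
  qed simp
  \<comment> \<open>If \<open>q < 0\<close> and \<open>e t\<close> were positive,
    \<open>e (Suc t)\<close> would be negative. So all errors vanish, including \<open>e 0\<close>,
    and the claimed bound becomes 0 \<le> 0 regardless of the sign of the power.\<close>
  have zero: "e t = 0" if "q < 0" for t
    using e_Suc[of t] e_nonneg[of t] e_nonneg[of "Suc t"] that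
    by (smt (verit) mult_neg_pos)
  have e0: "e 0 = frob_sq (X0 -\<^sub>t X_sol)"
    by (simp add: e_def err_def)
  show ?thesis
  proof
    fix t
    have "expectation (\<lambda>w. err (t + 1) (\<lambda>s. I s w)) = e (t + 1)"
      unfolding e_def
    proof (rule expectation_iid_prefix[OF assms(9,10) D finite_lessThan])
      fix a b :: "nat \<Rightarrow> nat" assume "\<And>s. s < t + 1 \<Longrightarrow> a s = b s"
      thus "err (t + 1) a = err (t + 1) b"
        unfolding err_def using kaczmarz_cong by metis
    qed
    moreover have "e (t + 1) \<le> q ^ (t + 1) * e 0"
      using pow[of "t + 1"] zero[of "t + 1"] zero[of 0] by (cases "0 \<le> q") auto
    ultimately show "expectation (\<lambda>w. frob_sq (kaczmarz A B X0 (\<lambda>s. I s w) (t + 1) -\<^sub>t X_sol))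
        \<le> (1 - sigma_min (expectation_mat D (l * n) (l * n) (\<lambda>i. bcirc (row_projection A i)))) ^ (t + 1)
          * frob_sq (X0 -\<^sub>t X_sol)"
      by (simp only: err_def q_def e0)
  qed
qed

end
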